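(* For all $j\in\mathbb N$ and all $0<x\le1$, $$\frac{|\phi_j(x)|}{x}\le C_0|\lambda_j|^3,\qquad\text{where } C_0=\frac13+\frac{1}{72\sqrt3\,e}.$$
   Context: Let $K:[0,1]\times[0,1]\to\mathbb R$ be defined by $K(x,y)=\frac12-\{(xy)^{-1}\}$ if $0<x,y\le 1$, and $K(x,y)=0$ if $0\le x,y\le1$ and $xy=0$, where $\{\alpha\}=\alpha-\lfloor\alpha\rfloor$. Let $L^2([0,1])$ denote the space of real-valued Lebesgue measurable square-integrable functions on $[0,1]$, with $\langle f,g\rangle=\int_0^1 f(x)g(x)\,dx$ and $\|f\|=\langle f,f\rangle^{1/2}$. A function $\phi$ is an eigenfunction of $K$ (with eigenvalue $\lambda\in\mathbb R$) if $\phi\in L^2([0,1])$, $\|\phi\|>0$, and $\phi(x)=\lambda\int_0^1 K(x,y)\phi(y)\,dy$ for every $x\in[0,1]$. Let $\phi_1,\phi_2,\ldots$ be a maximal orthonormal system in $L^2([0,1])$ of eigenfunctions of $K$, $\phi_j$ having the nonzero real eigenvalue $\lambda_j$, numbered so that $0<|\lambda_1|\le|\lambda_2|\le\cdots$ and $\lambda_j\ge\lambda_{j+1}$ whenever $|\lambda_j|=|\lambda_{j+1}|$. *)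

theory Defs
  imports "HOL-Analysis.Analysis"
begin

text \<open>The kernel K(x,y) = 1/2 - {1/(xy)} for xy > 0, and 0 when xy = 0
  (only its values on [0,1]^2 matter). frac is the library's fractional part.\<close>
definition K :: "real \<Rightarrow> real \<Rightarrow> real" where
  "K x y = (if x * y = 0 then 0 else 1/2 - frac (1 / (x * y)))"

definition L2 :: "(real \<Rightarrow> real) set" where
  "L2 = {f. f \<in> borel_measurable (lebesgue_on {0..1}) \<and>
            integrable (lebesgue_on {0..1}) (\<lambda>x. (f x)^2)}"

definition inner01 :: "(real \<Rightarrow> real) \<Rightarrow> (real \<Rightarrow> real) \<Rightarrow> real" where
  "inner01 f g = integral\<^sup>L (lebesgue_on {0..1}) (\<lambda>x. f x * g x)"

definition norm01 :: "(real \<Rightarrow> real) \<Rightarrow> real" where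
  "norm01 f = sqrt (inner01 f f)"

definition eigenfun :: "(real \<Rightarrow> real) \<Rightarrow> real \<Rightarrow> bool" where
  "eigenfun phi lam \<longleftrightarrow> phi \<in> L2 \<and> norm01 phi > 0 \<and>
     (\<forall>x\<in>{0..1}. phi x = lam * integral\<^sup>L (lebesgue_on {0..1}) (\<lambda>y. K x y * phi y))"

definition max_ortho_eigensystem :: "(nat \<Rightarrow> real \<Rightarrow> real) \<Rightarrow> (nat \<Rightarrow> real) \<Rightarrow> bool" where
  "max_ortho_eigensystem phi lam \<longleftrightarrow>
     (\<forall>j. eigenfun (phi j) (lam j) \<and> lam j \<noteq> 0) \<and>
     (\<forall>i j. inner01 (phi i) (phi j) = (if i = j then 1 else 0)) \<and>
     (\<forall>psi mu. eigenfun psi mu \<longrightarrow> \<not> (\<forall>j. inner01 psi (phi j) = 0)) \<and>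
     (\<forall>j. \<bar>lam j\<bar> \<le> \<bar>lam (Suc j)\<bar>) \<and>
     (\<forall>j. \<bar>lam j\<bar> = \<bar>lam (Suc j)\<bar> \<longrightarrow> lam j \<ge> lam (Suc j))"

definition C0 :: real where
  "C0 = 1/3 + 1 / (72 * sqrt 3 * exp 1)"

end

theory Submission
  imports Defs
begin

text \<open>
  An eigenfunction satisfies \<open>\<phi>(w) = \<lambda>\<^sup>2 \<integral> K\<^sub>2(w,z) \<phi>(z) dz\<close>, where
  \<open>K\<^sub>2(w,z) = \<integral> K(w,u) K(z,u) du\<close>. Integrating \<open>K(w,\<cdot>)\<close> by parts on the intervals where
  \<open>K(z,\<cdot>)\<close> is smooth gives \<open>\<bar>K\<^sub>2(w,z)\<bar> \<le> w/(4z)\<close>, besides the trivial bound \<open>1/4\<close>.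
  For fixed \<open>x > 0\<close> put \<open>m(z) = max z x\<close> and \<open>J = \<integral> \<bar>\<phi>\<bar>/m\<close>; then \<open>\<bar>\<phi>\<bar> \<le> (\<lambda>\<^sup>2/4) m J\<close> pointwise.
  Using this bound on \<open>[0,\<delta>]\<close> and \<open>\<parallel>\<phi>\<parallel> = 1\<close> with Cauchy-Schwarz on \<open>[\<delta>,1]\<close> yields
  \<open>J \<le> (\<lambda>\<^sup>2\<delta>/4) J + \<delta>\<^bsup>-1/2\<^esup>\<close>. The choice \<open>\<delta> = 4/(3\<lambda>\<^sup>2)\<close> gives \<open>J \<le> (3\<surd>3/4) \<bar>\<lambda>\<bar>\<close>, hence
  \<open>\<bar>\<phi>(x)\<bar>/x \<le> (3\<surd>3/16) \<bar>\<lambda>\<bar>\<^sup>3\<close>, and \<open>3\<surd>3/16 < 1/3 < C\<^sub>0\<close>.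
\<close>

section \<open>A continuous primitive of the sawtooth\<close>

text \<open>The constant \<open>1/16\<close> centres the range of the primitive, which halves its sup norm.\<close>

definition saw_primitive :: "real \<Rightarrow> real" where
  "saw_primitive t = frac t * (1 - frac t) / 2 - 1/16"

lemma abs_saw_primitive_le: "\<bar>saw_primitive t\<bar> \<le> 1/16"
proof -
  have "frac t * (1 - frac t) \<ge> 0"
    using frac_ge_0[of t] frac_lt_1[of t] by simp
  moreover have "frac t * (1 - frac t) \<le> 1/4"
    using zero_le_power2[of "frac t - 1/2"] by (simp add: power2_eq_square algebra_simps)
  ultimately show ?thesis
    unfolding saw_primitive_def by linarith
qed

text \<open>Between \<open>n - 1\<close> and \<open>n + 1\<close> the fractional part of
  \<open>s\<close> is \<open>|s - n|\<close> or \<open>1 - |s - n|\<close>, and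
  \<open>r * (1 - r)\<close> is unchanged when \<open>r\<close> becomes \<open>1 - r\<close>. So the
  one formula \<open>g\<close>, continuous across \<open>n\<close>, covers both sides.\<close>

lemma isCont_saw_primitive: "isCont saw_primitive t"
proof -
  define n where "n = \<lfloor>t\<rfloor>"
  define g where "g s = \<bar>s - of_int n\<bar> * (1 - \<bar>s - of_int n\<bar>) / 2 - 1/16" for s :: real
  have eq: "g s = saw_primitive s" if "s \<in> {of_int n - 1<..<of_int n + 1}" for s
  proof (cases "s \<ge> of_int n")
    case True
    then have "\<lfloor>s\<rfloor> = n" using that by (simp add: floor_eq_iff)
    then show ?thesis using True by (simp add: g_def saw_primitive_def frac_def)
  next
    case False
    then have "\<lfloor>s\<rfloor> = n - 1" using that by (simp add: floor_eq_iff)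
    then have "frac s = 1 - (of_int n - s)" by (simp add: frac_def)
    then show ?thesis using False
      by (simp add: g_def saw_primitive_def mult.commute)
  qed
  have t: "t \<in> {of_int n - 1<..<of_int n + 1}"
    unfolding n_def by (simp, linarith)
  have "isCont g t" unfolding g_def by (intro continuous_intros) auto
  moreover have "eventually (\<lambda>s. g s = saw_primitive s) (nhds t)"
    using eventually_nhds_in_open[OF _ t] by (rule eventually_mono) (auto simp: eq)
  ultimately show ?thesis using isCont_cong by blast
qed

lemma DERIV_saw_primitive:
  assumes "t \<notin> \<int>"
  shows "(saw_primitive has_real_derivative 1/2 - frac t) (at t)"
proof -
  define n where "n = \<lfloor>t\<rfloor>"
  define g where "g s = (s - of_int n) * (1 - (s - of_int n)) / 2 - 1/16" for s :: real
  have "t \<noteq> of_int n" using assms by auto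
  moreover have "of_int n \<le> t" "t < of_int n + 1" unfolding n_def by linarith+
  ultimately have t: "t \<in> {of_int n<..<of_int n + 1}" by auto
  have "(g has_real_derivative 1/2 - frac t) (at t)"
    unfolding g_def by (auto intro!: derivative_eq_intros simp: frac_def n_def field_simps)
  moreover have "g s = saw_primitive s" if "s \<in> {of_int n<..<of_int n + 1}" for s
  proof -
    have "\<lfloor>s\<rfloor> = n" using that by (simp add: floor_eq_iff)
    then show ?thesis by (simp add: g_def saw_primitive_def frac_def)
  qed
  ultimately show ?thesis
    using has_field_derivative_transform_within_open[OF _ _ t] by (metis open_greaterThanLessThan)
qed

section \<open>Elementary properties of the kernel\<close>

lemma K_commute: "K x y = K y x"
  by (simp add: K_def mult.commute)

lemma abs_K_le: "\<bar>K x y\<bar> \<le> 1/2"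
  using frac_ge_0[of "1 / (x * y)"] frac_lt_1[of "1 / (x * y)"]
  unfolding K_def by (simp add: abs_real_def)

text \<open>On the interval \<open>1 / (x * u)\<close> is positive and at most
  \<open>1 / (x * a)\<close>, so it takes finitely many integer values, each at a single
  \<open>u\<close>. These points are the exceptional set when the fundamental theorem of calculus is
  applied to \<open>K x\<close>.\<close>

lemma finite_inverse_int_points:
  fixes x a b :: real
  assumes "0 < x" "0 < a"
  shows "finite {u \<in> {a..b}. 1 / (x * u) \<in> \<int>}"
proof (rule finite_subset)
  show "{u \<in> {a..b}. 1 / (x * u) \<in> \<int>} \<subseteq> (\<lambda>m. 1 / (x * of_int m)) ` {0..\<lceil>1 / (x * a)\<rceil>}"
  proof
    fix u assume "u \<in> {u \<in> {a..b}. 1 / (x * u) \<in> \<int>}"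
    then obtain m where u: "a \<le> u" and m: "1 / (x * u) = of_int m"
      by (auto elim: Ints_cases)
    have pos: "0 < x * u" using assms u by simp
    have "of_int m \<le> 1 / (x * a)"
      unfolding m[symmetric] using assms u pos by (simp add: frac_le)
    then have "m \<le> \<lceil>1 / (x * a)\<rceil>" by linarith
    moreover have "0 \<le> m" using pos m by (metis of_int_0_le_iff zero_le_divide_1_iff less_imp_le)
    moreover have "u = 1 / (x * of_int m)" using pos assms m[symmetric] by (simp add: field_simps)
    ultimately show "u \<in> (\<lambda>m. 1 / (x * of_int m)) ` {0..\<lceil>1 / (x * a)\<rceil>}" by auto
  qed
qed simp

section \<open>Integration by parts on single pieces, and their summation\<close>

text \<open>By the chain rule \<open>K x u\<close> is \<open>- x * u^2\<close> times the derivative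
  of \<open>saw_primitive (1 / (x * u))\<close>; integrating by parts thus gains the factor
  \<open>x\<close>. The factor \<open>c - 1 / (z * u)\<close> stands for \<open>K z u\<close> on a
  piece where the floor of \<open>1 / (z * u)\<close> is constant.\<close>

lemma integral_K_smooth_bound:
  fixes x z c a b :: real
  assumes x: "0 < x" and z: "0 < z" and ab: "0 < a" "a \<le> b"
    and c: "\<And>u. u \<in> {a..b} \<Longrightarrow> \<bar>c - 1 / (z * u)\<bar> \<le> 1/2"
  obtains I where "((\<lambda>u. K x u * (c - 1 / (z * u))) has_integral I) {a..b}"
    and "\<bar>I\<bar> \<le> x / 16 * (b\<^sup>2 + (b - a) / z)"
proof -
  define P where "P u = saw_primitive (1 / (x * u))" for u
  define m where "m u = - (x * u\<^sup>2 * P u) * (c - 1 / (z * u))" for u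
  \<comment> \<open>\<open>e\<close> is what the product rule leaves over: \<open>m' = f - e\<close> off the jumps of \<open>K x\<close>.\<close>
  define e where "e u = x * P u * (2 * u * (c - 1 / (z * u)) + 1 / z)" for u
  define f where "f u = K x u * (c - 1 / (z * u))" for u
  define S where "S = {u \<in> {a..b}. 1 / (x * u) \<in> \<int>}"
  have P_le: "\<bar>P u\<bar> \<le> 1/16" for u
    unfolding P_def by (rule abs_saw_primitive_le)
  have contP: "continuous_on {a..b} P"
    unfolding P_def
  proof (rule continuous_on_compose2[of UNIV saw_primitive])
    show "continuous_on UNIV saw_primitive"
      using isCont_saw_primitive by (simp add: continuous_at_imp_continuous_on)
    show "continuous_on {a..b} (\<lambda>u. 1 / (x * u))"
      using x ab by (intro continuous_intros) auto
  qed simp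
  have contm: "continuous_on {a..b} m" and conte: "continuous_on {a..b} e"
    unfolding m_def e_def using x z ab by (auto intro!: continuous_intros contP)
  have m': "(m has_vector_derivative f u - e u) (at u)" if "u \<in> {a<..<b} - S" for u
  proof -
    have u: "0 < u" and nz: "1 / (x * u) \<notin> \<int>" using that ab by (auto simp: S_def)
    have "((\<lambda>u. 1 / (x * u)) has_real_derivative - (1 / (x * u\<^sup>2))) (at u)"
      using x u by (auto intro!: derivative_eq_intros simp: field_simps power2_eq_square)
    from DERIV_chain2[OF DERIV_saw_primitive[OF nz] this]
    have P': "(P has_real_derivative - (K x u / (x * u\<^sup>2))) (at u)"
      using x u by (simp add: P_def[abs_def] K_def)
    have "((\<lambda>u. x * u\<^sup>2) has_real_derivative 2 * x * u) (at u)"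
      by (auto intro!: derivative_eq_intros)
    from DERIV_mult[OF this P']
    have D1: "((\<lambda>u. x * u\<^sup>2 * P u) has_real_derivative 2 * x * u * P u - K x u) (at u)"
      using x u by simp
    have D2: "((\<lambda>u. c - 1 / (z * u)) has_real_derivative 1 / (z * u\<^sup>2)) (at u)"
      using z u by (auto intro!: derivative_eq_intros simp: field_simps power2_eq_square)
    have "- (2 * x * u * P u - K x u) * (c - 1 / (z * u)) + 1 / (z * u\<^sup>2) * - (x * u\<^sup>2 * P u)
        = f u - e u"
      using u z by (simp add: f_def e_def algebra_simps)
    with DERIV_mult[OF DERIV_minus[OF D1] D2]
    have "(m has_real_derivative f u - e u) (at u)"
      unfolding m_def by simp
    then show ?thesis by (simp add: has_real_derivative_iff_has_vector_derivative)
  qed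
  have "finite S" unfolding S_def using x ab(1) by (rule finite_inverse_int_points)
  then have fe: "((\<lambda>u. f u - e u) has_integral (m b - m a)) {a..b}"
    using ab(2) m' contm by (rule fundamental_theorem_of_calculus_interior_strong)
  have ie: "(e has_integral integral {a..b} e) {a..b}"
    using conte by (simp add: integrable_continuous_real integrable_integral)
  have f: "(f has_integral (m b - m a + integral {a..b} e)) {a..b}"
    using has_integral_add[OF fe ie] by simp
  have m_le: "\<bar>m u\<bar> \<le> x * u\<^sup>2 / 32" if "u \<in> {a..b}" for u
  proof -
    have "\<bar>m u\<bar> = x * u\<^sup>2 * (\<bar>P u\<bar> * \<bar>c - 1 / (z * u)\<bar>)"
      unfolding m_def using x by (simp add: abs_mult)
    also have "\<dots> \<le> x * u\<^sup>2 * (1/16 * (1/2))"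
      using x P_le c[OF that] by (intro mult_left_mono mult_mono) auto
    finally show ?thesis by simp
  qed
  have e_le: "\<bar>e u\<bar> \<le> x / 16 * (u + 1 / z)" if "u \<in> {a..b}" for u
  proof -
    have u: "0 < u" using that ab by simp
    have "\<bar>2 * u * (c - 1 / (z * u)) + 1 / z\<bar> \<le> 2 * u * \<bar>c - 1 / (z * u)\<bar> + 1 / z"
      using u z by (intro order_trans[OF abs_triangle_ineq]) (simp add: abs_mult)
    also have "\<dots> \<le> u + 1 / z"
      using mult_left_mono[OF c[OF that], of "2 * u"] u by simp
    finally have *: "\<bar>2 * u * (c - 1 / (z * u)) + 1 / z\<bar> \<le> u + 1 / z" .
    have "\<bar>e u\<bar> = x * (\<bar>P u\<bar> * \<bar>2 * u * (c - 1 / (z * u)) + 1 / z\<bar>)"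
      unfolding e_def using x by (simp add: abs_mult)
    also have "\<dots> \<le> x * (1/16 * (u + 1 / z))"
      using x P_le * by (intro mult_left_mono mult_mono) auto
    finally show ?thesis by simp
  qed
  have bnd: "((\<lambda>u. x / 16 * (u + 1 / z)) has_integral
      (x / 16 * (b\<^sup>2 / 2 + b / z) - x / 16 * (a\<^sup>2 / 2 + a / z))) {a..b}"
    using ab(2) z by (intro fundamental_theorem_of_calculus)
      (auto intro!: derivative_eq_intros simp flip: has_real_derivative_iff_has_vector_derivative)
  have "\<bar>integral {a..b} e\<bar> \<le> x / 16 * (b\<^sup>2 / 2 + b / z) - x / 16 * (a\<^sup>2 / 2 + a / z)"
    using integral_norm_bound_integral[OF has_integral_integrable[OF ie] has_integral_integrable[OF bnd]]
      e_le unfolding integral_unique[OF bnd] by simp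
  moreover have "\<bar>m b\<bar> \<le> x * b\<^sup>2 / 32" "\<bar>m a\<bar> \<le> x * a\<^sup>2 / 32" using ab m_le by auto
  ultimately have "\<bar>m b - m a + integral {a..b} e\<bar> \<le>
      x * b\<^sup>2 / 32 + x * a\<^sup>2 / 32 + (x / 16 * (b\<^sup>2 / 2 + b / z) - x / 16 * (a\<^sup>2 / 2 + a / z))"
    by linarith
  \<comment> \<open>The boundary contribution \<open>x * a^2 / 32\<close> cancels against the
    \<open>a^2\<close> term of the bound on the integral of \<open>e\<close>.\<close>
  also have "\<dots> = x / 16 * (b\<^sup>2 + (b - a) / z)" using z by (simp add: field_simps)
  finally show ?thesis using that f unfolding f_def by blast
qed

text \<open>Between consecutive jumps of \<open>K z\<close> the floor of \<open>1 / (z * u)\<close>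
  is \<open>n\<close>, so the previous bound applies with \<open>c = 1/2 + n\<close>. Writing
  \<open>upper\<close> without division keeps it meaningful at \<open>n = 0\<close>.\<close>

lemma integral_KK_piece_bound:
  fixes x z a b :: real and n :: nat
  assumes x: "0 < x" and z: "0 < z" and ab: "0 < a" "a \<le> b"
    and lower: "1 / (z * real (Suc n)) \<le> a" and upper: "z * b * real n \<le> 1"
  obtains I where "((\<lambda>u. K x u * K z u) has_integral I) {a..b}"
    and "\<bar>I\<bar> \<le> x / 16 * (b\<^sup>2 + (b - a) / z)"
proof -
  have range: "real n \<le> 1 / (z * u)" "1 / (z * u) \<le> real n + 1" if "u \<in> {a..b}" for u
  proof -
    have u: "0 < u" using that ab by simp
    have "z * u * real n \<le> z * b * real n"
      using that z by (intro mult_right_mono mult_left_mono) auto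
    then have "z * u * real n \<le> 1" using upper by linarith
    then show "real n \<le> 1 / (z * u)" using z u by (simp add: field_simps)
    have "1 / (z * real (Suc n)) \<le> u" using lower that by simp
    then have "1 \<le> u * (z * real (Suc n))" using z by (subst (asm) pos_divide_le_eq) auto
    then show "1 / (z * u) \<le> real n + 1" using z u by (simp add: field_simps)
  qed
  have "\<bar>(1/2 + real n) - 1 / (z * u)\<bar> \<le> 1/2" if "u \<in> {a..b}" for u
    using range[OF that] by linarith
  from integral_K_smooth_bound[OF x z ab this]
  obtain I where I: "((\<lambda>u. K x u * (1/2 + real n - 1 / (z * u))) has_integral I) {a..b}"
    "\<bar>I\<bar> \<le> x / 16 * (b\<^sup>2 + (b - a) / z)" by blast
  have "((\<lambda>u. K x u * K z u) has_integral I) {a..b}"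
  proof (rule has_integral_spike_finite[OF _ _ I(1)])
    \<comment> \<open>At this one point the floor is already \<open>n + 1\<close>, and the formula
      for \<open>K z u\<close> fails.\<close>
    show "finite {1 / (z * real (Suc n))}" by simp
    fix u assume u: "u \<in> {a..b} - {1 / (z * real (Suc n))}"
    have u0: "0 < u" using u ab by auto
    have "1 / (z * u) \<noteq> real n + 1"
    proof
      assume "1 / (z * u) = real n + 1"
      then have "u * (z * real (Suc n)) = 1" using z u0 by (simp add: field_simps)
      then have "u = 1 / (z * real (Suc n))" using z by (subst eq_divide_eq) auto
      then show False using u by simp
    qed
    then have "\<lfloor>1 / (z * u)\<rfloor> = int n"
      using range[of u] u by (simp add: floor_eq_iff)
    then show "K x u * K z u = K x u * (1/2 + real n - 1 / (z * u))"
      using z u0 by (simp add: K_def frac_def)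
  qed
  then show ?thesis using that I(2) by blast
qed

text \<open>Induction attaches one piece at a time on the left. The piece ending at 1 accounts for
  the summand 1; each further piece costs at most \<open>3 * (b - a) / z\<close>, and these lengths
  telescope.\<close>

lemma integral_KK_tail_bound:
  fixes x z :: real and N :: nat
  assumes x: "0 < x" and z: "0 < z" "z \<le> 1" and N: "Suc (nat \<lfloor>1 / z\<rfloor>) \<le> N"
  shows "\<exists>I. ((\<lambda>u. K x u * K z u) has_integral I) {1 / (z * real N)..1} \<and>
    \<bar>I\<bar> \<le> x / 16 * (1 + 3 * (1 - 1 / (z * real N)) / z)"
  using N
proof (induction N rule: dec_induct)
  case base
  \<comment> \<open>The floor of \<open>1 / (z * u)\<close> at \<open>u = 1\<close>; the first piece
    ends at 1 rather than at a jump of \<open>K z\<close>.\<close>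
  define n where "n = nat \<lfloor>1 / z\<rfloor>"
  define a where "a = 1 / (z * real (Suc n))"
  have "real n = of_int \<lfloor>1 / z\<rfloor>" using z by (simp add: n_def)
  then have n: "real n \<le> 1 / z" "1 / z < real n + 1" by linarith+
  have a: "0 < a" "a \<le> 1" using n z by (auto simp: a_def field_simps)
  have "z * 1 * real n \<le> 1" using n z by (simp add: field_simps)
  with integral_KK_piece_bound[OF x z(1) a, of n]
  obtain I where I: "((\<lambda>u. K x u * K z u) has_integral I) {a..1}"
    "\<bar>I\<bar> \<le> x / 16 * (1\<^sup>2 + (1 - a) / z)" unfolding a_def by blast
  note I(2)
  also have "x / 16 * (1\<^sup>2 + (1 - a) / z) \<le> x / 16 * (1 + 3 * (1 - a) / z)"
    using x z a by (intro mult_left_mono) (auto simp: field_simps)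
  finally show ?case using I(1) unfolding a_def n_def by blast
next
  case (step N)
  define a where "a = 1 / (z * real (Suc N))"
  define b where "b = 1 / (z * real N)"
  have N: "1 \<le> real N" using step.hyps by simp
  have "0 < a" unfolding a_def using z by (intro divide_pos_pos mult_pos_pos) auto
  moreover have "a \<le> b"
    unfolding a_def b_def using z N by (intro divide_left_mono mult_left_mono mult_pos_pos) auto
  ultimately have a: "0 < a" "a \<le> b" .
  have "1 / z < real (Suc (nat \<lfloor>1 / z\<rfloor>))"
    using z by (simp add: of_nat_nat) linarith
  also have "\<dots> \<le> real N" using step.hyps by simp
  finally have b1: "b \<le> 1" using z N by (simp add: b_def field_simps)
  from step.IH obtain I where I: "((\<lambda>u. K x u * K z u) has_integral I) {b..1}"
    "\<bar>I\<bar> \<le> x / 16 * (1 + 3 * (1 - b) / z)" unfolding b_def by blast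
  have "z * b * real N \<le> 1" using z N by (simp add: b_def)
  with integral_KK_piece_bound[OF x z(1) a, of N]
  obtain J where J: "((\<lambda>u. K x u * K z u) has_integral J) {a..b}"
    "\<bar>J\<bar> \<le> x / 16 * (b\<^sup>2 + (b - a) / z)" unfolding a_def by blast
  define r where "r = real N"
  have r: "1 \<le> r" and a_eq: "a = 1 / (z * (r + 1))" and b_eq: "b = 1 / (z * r)"
    using N by (simp_all add: a_def b_def r_def add.commute)
  have "1 / (z * r) - 1 / (z * q) = (q - r) / (z * (r * q))" if "0 < q" for q
    using z r that by (simp add: field_simps)
  from this[of "r + 1"] have diff: "b - a = 1 / (z * (r * (r + 1)))"
    using r by (simp add: a_eq b_eq)
  \<comment> \<open>The quotient of \<open>b^2\<close> by \<open>(b - a) / z\<close> is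
    \<open>(r + 1) / r\<close>, at most 2 since \<open>r \<ge> 1\<close>; the comparison is made
    after multiplying by \<open>z^2\<close>.\<close>
  have "b\<^sup>2 * z\<^sup>2 = 2 / (r * (r + r))"
    using z r by (simp add: b_eq power2_eq_square)
  also have "\<dots> \<le> 2 / (r * (r + 1))"
    using r by (intro divide_left_mono mult_left_mono mult_pos_pos) auto
  also have "\<dots> = 2 * (b - a) / z * z\<^sup>2"
    using z by (simp add: diff power2_eq_square)
  finally have "b\<^sup>2 \<le> 2 * (b - a) / z" by (rule mult_right_le_imp_le) (use z in simp)
  then have "b\<^sup>2 + (b - a) / z \<le> 3 * (b - a) / z" by (simp add: diff_divide_distrib)
  then have "x / 16 * (b\<^sup>2 + (b - a) / z) \<le> x / 16 * (3 * (b - a) / z)"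
    using x by (intro mult_left_mono) auto
  with I(2) J(2)
  have "\<bar>J + I\<bar> \<le> x / 16 * (3 * (b - a) / z) + x / 16 * (1 + 3 * (1 - b) / z)" by linarith
  also have "\<dots> = x / 16 * (1 + 3 * (1 - a) / z)" using z by (simp add: field_simps)
  finally have "\<bar>J + I\<bar> \<le> x / 16 * (1 + 3 * (1 - a) / z)" .
  moreover have "((\<lambda>u. K x u * K z u) has_integral (J + I)) {a..1}"
    using has_integral_combine[OF a(2) b1 J(1) I(1)] .
  ultimately show ?case unfolding a_def by blast
qed

section \<open>Bounds for the iterated kernel on the unit interval\<close>

abbreviation unit_interval_measure :: "real measure" (\<open>\<mu>\<close>) where
  "\<mu> \<equiv> lebesgue_on {0..1}"

interpretation \<mu>: finite_measure \<mu>
  by (rule finite_measure_lebesgue_on) simp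

lemma borel_measurable_case_prod_K: "case_prod K \<in> borel_measurable (borel \<Otimes>\<^sub>M borel)"
  unfolding K_def frac_def split_beta' by measurable

lemma borel_measurable_K [measurable (raw)]:
  assumes "f \<in> borel_measurable M" "g \<in> borel_measurable M"
  shows "(\<lambda>w. K (f w) (g w)) \<in> borel_measurable M"
  using measurable_compose[OF measurable_Pair[OF assms] borel_measurable_case_prod_K] by simp

lemma borel_measurable_id_\<mu> [measurable (raw)]: "(\<lambda>x. x) \<in> borel_measurable \<mu>"
  by (intro measurable_restrict_space1 measurable_completion) simp

lemma measure_\<mu>: "measure \<mu> (space \<mu>) = 1"
  by (simp add: measure_restrict_space)

lemma abs_KK_le: "\<bar>K x u * K z u\<bar> \<le> 1/4"
  using mult_mono[OF abs_K_le[of x u] abs_K_le[of z u]] by (simp add: abs_mult)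

lemma integrable_KK: "integrable \<mu> (\<lambda>u. K x u * K z u)"
proof (rule \<mu>.integrable_const_bound)
  show "AE u in \<mu>. norm (K x u * K z u) \<le> 1/4" using abs_KK_le by simp
qed measurable

lemma abs_integral_KK_le_quarter: "\<bar>LINT u|\<mu>. K x u * K z u\<bar> \<le> 1/4"
proof -
  have "\<bar>LINT u|\<mu>. K x u * K z u\<bar> \<le> (LINT u|\<mu>. 1/4)"
    using abs_KK_le integrable_KK by (intro order_trans[OF integral_abs_bound] integral_mono) auto
  then show ?thesis using measure_\<mu> by simp
qed

text \<open>The tail bound stays below \<open>x / 16 * (1 + 3 / z)\<close> however small the lower
  end \<open>a\<close> is, and the remaining interval \<open>{0..a}\<close> contributes at most
  \<open>a / 4\<close>.\<close>

lemma abs_integral_KK_le_ratio: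
  fixes x z :: real
  assumes x: "0 < x" and z: "0 < z" "z \<le> 1"
  shows "\<bar>LINT u|\<mu>. K x u * K z u\<bar> \<le> x / (4 * z)"
proof -
  define f where "f u = K x u * K z u" for u
  have int: "integrable \<mu> f" unfolding f_def by (rule integrable_KK)
  have f: "f integrable_on {0..1}" and eq: "integral\<^sup>L \<mu> f = integral {0..1} f"
    using integrable_on_lebesgue_on[OF int] lebesgue_integral_eq_integral[OF int] by auto
  have "\<bar>integral {0..1} f\<bar> \<le> x / 16 * (1 + 3 / z)"
  proof (rule field_le_epsilon)
    fix e :: real assume e: "0 < e"
    obtain M :: nat where M: "1 / (4 * z * e) < real M" using reals_Archimedean2 by blast
    \<comment> \<open>\<open>M\<close> forces \<open>a / 4 \<le> e\<close>; the other summand meets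
      the requirement of the tail bound.\<close>
    define N where "N = M + Suc (nat \<lfloor>1 / z\<rfloor>)"
    define a where "a = 1 / (z * real N)"
    have N: "1 / (4 * z * e) < real N" "0 < real N" "1 / z < real N"
    proof -
      have "real (nat \<lfloor>1 / z\<rfloor>) = of_int \<lfloor>1 / z\<rfloor>" using z by simp
      then show "1 / z < real N" unfolding N_def by simp linarith
      show "1 / (4 * z * e) < real N" using M unfolding N_def by linarith
      show "0 < real N" unfolding N_def by simp
    qed
    have a: "0 < a" "a \<le> 1" "a / 4 \<le> e"
      using N z e by (auto simp: a_def field_simps)
    from integral_KK_tail_bound[OF x z, of N] obtain I
      where I: "(f has_integral I) {a..1}" "\<bar>I\<bar> \<le> x / 16 * (1 + 3 * (1 - a) / z)"
      unfolding f_def a_def N_def by force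
    have "x / 16 * (1 + 3 * (1 - a) / z) \<le> x / 16 * (1 + 3 / z)"
      using x z a by (intro mult_left_mono) (auto simp: field_simps)
    then have tail: "\<bar>integral {a..1} f\<bar> \<le> x / 16 * (1 + 3 / z)"
      using I(2) integral_unique[OF I(1)] by linarith
    have "f integrable_on {0..a}"
      using integrable_subinterval_real[OF f] a by auto
    then have "norm (integral {0..a} f) \<le> integral {0..a} (\<lambda>u. 1/4)"
      by (rule integral_norm_bound_integral) (use abs_KK_le in \<open>auto simp: f_def\<close>)
    then have "\<bar>integral {0..a} f\<bar> \<le> a / 4" using a by simp
    moreover have "integral {0..a} f + integral {a..1} f = integral {0..1} f"
      using a f by (intro Henstock_Kurzweil_Integration.integral_combine) auto
    ultimately show "\<bar>integral {0..1} f\<bar> \<le> x / 16 * (1 + 3 / z) + e"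
      using tail a by linarith
  qed
  \<comment> \<open>Uses \<open>1 \<le> 1 / z\<close>.\<close>
  also have "\<dots> \<le> x / (4 * z)" using x z by (simp add: field_simps)
  finally show ?thesis using eq unfolding f_def by simp
qed

text \<open>For \<open>z \<ge> x\<close> this is the ratio bound; for \<open>z < x\<close> the bound
  \<open>1/4\<close> suffices, as then \<open>max z x = x \<le> max w x\<close>. Truncating at
  \<open>x\<close> keeps the weight \<open>1 / max z x\<close> bounded near 0.\<close>

lemma abs_integral_KK_le_max_ratio:
  fixes w z x :: real
  assumes "0 \<le> w" "0 \<le> z" "z \<le> 1" and x: "0 < x"
  shows "\<bar>LINT u|\<mu>. K w u * K z u\<bar> \<le> max w x / (4 * max z x)"
proof (cases "w = 0 \<or> z = 0")
  case True
  then show ?thesis using x by (auto simp: K_def)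
next
  case False
  show ?thesis
  proof (cases "x \<le> z")
    case True
    have "\<bar>LINT u|\<mu>. K w u * K z u\<bar> \<le> w / (4 * z)"
      using False assms by (intro abs_integral_KK_le_ratio) auto
    also have "\<dots> \<le> max w x / (4 * max z x)"
      using True assms by (simp add: divide_right_mono)
    finally show ?thesis .
  next
    case False
    then have "1/4 \<le> max w x / (4 * max z x)" using x by (simp add: field_simps)
    then show ?thesis using abs_integral_KK_le_quarter[of w z] by linarith
  qed
qed

section \<open>From the iterated kernel to eigenfunctions\<close>

text \<open>The estimate for \<open>J\<close> refers to \<open>J\<close> itself and is closed by
  absorbing \<open>J / 3\<close>. The truncation makes the integrand of \<open>J\<close> integrable
  before any decay of \<open>phi\<close> at 0 is known.\<close>

lemma eigenfun_linear_bound: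
  fixes phi :: "real \<Rightarrow> real" and lam x :: real
  assumes eigen: "eigenfun phi lam" and unit: "inner01 phi phi = 1" and lam: "lam \<noteq> 0"
    and x: "x \<in> {0<..1}"
  shows "\<bar>phi x\<bar> \<le> 3 * sqrt 3 / 16 * \<bar>lam\<bar> ^ 3 * x"
proof -
  have [measurable]: "phi \<in> borel_measurable \<mu>" and sq: "integrable \<mu> (\<lambda>z. (phi z)\<^sup>2)"
    and eq: "\<And>y. y \<in> {0..1} \<Longrightarrow> phi y = lam * (LINT z|\<mu>. K y z * phi z)"
    using eigen by (auto simp: eigenfun_def L2_def)
  have norm: "(LINT z|\<mu>. (phi z)\<^sup>2) = 1"
    using unit by (simp add: inner01_def power2_eq_square)
  have int_phi: "integrable \<mu> phi"
  proof (rule Bochner_Integration.integrable_bound)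
    show "integrable \<mu> (\<lambda>z. 1 + (phi z)\<^sup>2)" using sq by simp
    have "\<bar>t\<bar> \<le> 1 + t\<^sup>2" for t :: real
      using zero_le_power2[of "\<bar>t\<bar> - 1/2"] by (simp add: power2_eq_square algebra_simps)
    then show "AE z in \<mu>. norm (phi z) \<le> norm (1 + (phi z)\<^sup>2)" by (simp add: abs_of_nonneg)
  qed measurable
  \<comment> \<open>A crude sup bound for \<open>phi\<close>, which secures integrability for
    \<open>J\<close> and for Fubini; its size does not enter the result.\<close>
  define B where "B = \<bar>lam\<bar> * (LINT z|\<mu>. \<bar>phi z\<bar>)"
  have abs_K_phi: "\<bar>K y z * phi z\<bar> \<le> \<bar>phi z\<bar>" for y z
    using mult_right_mono[OF order_trans[OF abs_K_le[of y z], of 1], of "\<bar>phi z\<bar>"]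
    by (simp add: abs_mult)
  have int_K_phi: "integrable \<mu> (\<lambda>z. K y z * phi z)" for y
    by (rule Bochner_Integration.integrable_bound[OF int_phi]) (use abs_K_phi in auto)
  have B: "\<bar>phi y\<bar> \<le> B" if "y \<in> {0..1}" for y
  proof -
    have "\<bar>LINT z|\<mu>. K y z * phi z\<bar> \<le> (LINT z|\<mu>. \<bar>phi z\<bar>)"
      using abs_K_phi int_K_phi int_phi
      by (intro order_trans[OF integral_abs_bound] integral_mono) auto
    then show ?thesis
      unfolding eq[OF that] B_def by (simp add: abs_mult mult_left_mono)
  qed
  have B0: "0 \<le> B" using B[of 0] by simp

  define m where "m z = max z x" for z
  have m_pos: "0 < m z" "x \<le> m z" "z \<le> m z" for z using x by (auto simp: m_def)
  have [measurable]: "m \<in> borel_measurable \<mu>" unfolding m_def by measurable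
  have int_phi_m: "integrable \<mu> (\<lambda>z. \<bar>phi z\<bar> / m z)"
  proof (rule \<mu>.integrable_const_bound)
    show "AE z in \<mu>. norm (\<bar>phi z\<bar> / m z) \<le> B / x"
      using B B0 m_pos x by (intro AE_I2) (auto intro!: frac_le simp: abs_of_pos)
  qed measurable
  define J where "J = (LINT z|\<mu>. \<bar>phi z\<bar> / m z)"
  have J0: "0 \<le> J" unfolding J_def using m_pos by (intro integral_nonneg_AE) (auto intro!: divide_nonneg_pos)

  have phi_le: "\<bar>phi w\<bar> \<le> lam\<^sup>2 / 4 * m w * J" if w: "w \<in> {0..1}" for w
  proof -
    interpret pair: pair_sigma_finite \<mu> \<mu>
      by (intro pair_sigma_finite.intro \<mu>.sigma_finite_measure_axioms)
    interpret prod: finite_measure "\<mu> \<Otimes>\<^sub>M \<mu>"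
      by (intro finite_measure_pair_measure \<mu>.finite_measure_axioms)
    have [measurable]: "fst \<in> borel_measurable (\<mu> \<Otimes>\<^sub>M \<mu>)" "snd \<in> borel_measurable (\<mu> \<Otimes>\<^sub>M \<mu>)"
      using measurable_compose[OF measurable_fst borel_measurable_id_\<mu>]
        measurable_compose[OF measurable_snd borel_measurable_id_\<mu>] by auto
    have int: "integrable (\<mu> \<Otimes>\<^sub>M \<mu>) (\<lambda>(z, y). phi z * (K w y * K z y))"
    proof (rule prod.integrable_const_bound)
      have "\<bar>phi z * (K w y * K z y)\<bar> \<le> B * (1/4)" if "z \<in> {0..1}" for z y
        unfolding abs_mult[of "phi z"] using B[OF that] abs_KK_le B0 by (intro mult_mono) auto
      then show "AE p in \<mu> \<Otimes>\<^sub>M \<mu>. norm (case p of (z, y) \<Rightarrow> phi z * (K w y * K z y)) \<le> B * (1/4)"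
        by (intro AE_I2) (auto simp: space_pair_measure)
      show "(\<lambda>(z, y). phi z * (K w y * K z y)) \<in> borel_measurable (\<mu> \<Otimes>\<^sub>M \<mu>)"
        unfolding split_beta' by (intro borel_measurable_times borel_measurable_K) measurable
    qed
    have "phi w = lam * (LINT y|\<mu>. K w y * phi y)" by (rule eq[OF w])
    \<comment> \<open>The eigenvalue equation is inserted a second time, now for
      \<open>phi y\<close>; symmetry of \<open>K\<close> prepares the iterated kernel.\<close>
    also have "(LINT y|\<mu>. K w y * phi y) = (LINT y|\<mu>. lam * (LINT z|\<mu>. phi z * (K w y * K z y)))"
    proof (rule Bochner_Integration.integral_cong[OF refl])
      fix y assume "y \<in> space \<mu>"
      then have "K w y * phi y = lam * (K w y * (LINT z|\<mu>. K y z * phi z))" using eq[of y] by simp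
      also have "K w y * (LINT z|\<mu>. K y z * phi z) = (LINT z|\<mu>. K w y * (K y z * phi z))"
        by simp
      also have "\<dots> = (LINT z|\<mu>. phi z * (K w y * K z y))"
        by (simp add: K_commute[of y] mult_ac)
      finally show "K w y * phi y = lam * (LINT z|\<mu>. phi z * (K w y * K z y))" .
    qed
    also have "\<dots> = lam * (LINT z|\<mu>. (LINT y|\<mu>. phi z * (K w y * K z y)))"
      using pair.Fubini_integral[OF int] by simp
    finally have "phi w = lam\<^sup>2 * (LINT z|\<mu>. phi z * (LINT y|\<mu>. K w y * K z y))"
      by (simp add: power2_eq_square)
    moreover have "\<bar>LINT z|\<mu>. phi z * (LINT y|\<mu>. K w y * K z y)\<bar> \<le> (LINT z|\<mu>. m w / 4 * (\<bar>phi z\<bar> / m z))"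
    proof (rule order_trans[OF integral_abs_bound], rule integral_mono)
      show "integrable \<mu> (\<lambda>z. \<bar>phi z * (LINT y|\<mu>. K w y * K z y)\<bar>)"
        using pair.integrable_fst[OF int] by simp
      show "integrable \<mu> (\<lambda>z. m w / 4 * (\<bar>phi z\<bar> / m z))"
        using int_phi_m by (rule integrable_mult_right)
      fix z assume "z \<in> space \<mu>"
      then have "\<bar>LINT y|\<mu>. K w y * K z y\<bar> \<le> m w / (4 * m z)"
        using w x unfolding m_def by (intro abs_integral_KK_le_max_ratio) auto
      then have "\<bar>phi z\<bar> * \<bar>LINT y|\<mu>. K w y * K z y\<bar> \<le> \<bar>phi z\<bar> * (m w / (4 * m z))"
        by (rule mult_left_mono) simp
      then show "\<bar>phi z * (LINT y|\<mu>. K w y * K z y)\<bar> \<le> m w / 4 * (\<bar>phi z\<bar> / m z)"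
        by (simp add: abs_mult mult_ac)
    qed
    moreover have "(LINT z|\<mu>. m w / 4 * (\<bar>phi z\<bar> / m z)) = m w / 4 * J"
      unfolding J_def by (rule integral_mult_right_zero)
    ultimately have "\<bar>phi w\<bar> \<le> lam\<^sup>2 * (m w / 4 * J)"
      by (simp only: abs_mult abs_power2 mult_left_mono zero_le_power2)
    then show ?thesis by simp
  qed

  \<comment> \<open>This cut maximises \<open>sqrt d * (1 - lam^2 * d / 4)\<close>, hence gives the
    least bound on \<open>J\<close>; \<open>s\<close> is \<open>1 / sqrt d\<close>.\<close>
  define d where "d = 4 / (3 * lam\<^sup>2)"
  define s where "s = \<bar>lam\<bar> * sqrt 3 / 2"
  have d: "0 < d" "d * lam\<^sup>2 = 4/3" using lam by (auto simp: d_def)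
  have s: "0 < s" "1 / d = s * s"
    using lam by (auto simp: d_def s_def power2_eq_square field_simps)
  define A where "A = lam\<^sup>2 / 4 * J"
  have phi_m_le: "\<bar>phi z\<bar> / m z \<le> A" if "z \<in> {0..1}" for z
    using phi_le[OF that] m_pos(1)[of z] by (simp add: A_def field_simps)
  have "J \<le> 3 / 2 * s"
  proof (cases "1 \<le> d")
    \<comment> \<open>The cut is at or beyond the right end, so \<open>A\<close> bounds the whole
      integrand and \<open>J \<le> J / 3\<close>.\<close>
    case True
    have "J \<le> (LINT z|\<mu>. A)"
      unfolding J_def using int_phi_m phi_m_le by (intro integral_mono) auto
    then have "J \<le> lam\<^sup>2 * J / 4" using measure_\<mu> by (simp add: A_def)
    also have "\<dots> \<le> d * lam\<^sup>2 * J / 4"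
      using True J0 mult_right_mono[of 1 d "lam\<^sup>2 * J"] by simp
    finally have "J \<le> 0" using J0 unfolding d by simp
    then show ?thesis using s by simp
  next
    case False
    \<comment> \<open>Beyond \<open>d\<close>, Cauchy-Schwarz is used in the pointwise form
      \<open>|phi| / z \<le> s / 2 * phi^2 + 1 / (2 * s * z^2)\<close>. The weight \<open>s\<close>
      balances the terms: each integrates to at most \<open>s / 2\<close> over
      \<open>{d..1}\<close>.\<close>
    define g where "g z = (if z \<le> d then A else 1 / (2 * s * z\<^sup>2))" for z
    have "\<bar>phi z\<bar> / m z \<le> s / 2 * (phi z)\<^sup>2 + g z" if z: "z \<in> {0..1}" for z
    proof (cases "z \<le> d")
      case True
      then show ?thesis using phi_m_le[OF z] s by (simp add: g_def add_increasing)
    next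
      case False
      then have z0: "0 < z" using d by simp
      have "\<bar>phi z\<bar> / m z \<le> \<bar>phi z\<bar> / z" using m_pos[of z] z0 by (intro divide_left_mono) auto
      also have "\<dots> \<le> s / 2 * (phi z)\<^sup>2 + 1 / (2 * s * z\<^sup>2)"
      proof -
        have "0 \<le> (s * \<bar>phi z\<bar> - 1 / z)\<^sup>2 / (2 * s)" using s by simp
        also have "\<dots> = s / 2 * (phi z)\<^sup>2 + 1 / (2 * s * z\<^sup>2) - \<bar>phi z\<bar> / z"
          using s(1) z0 by (simp add: power2_diff field_simps power2_eq_square)
        finally show ?thesis by simp
      qed
      finally show ?thesis using False by (simp add: g_def)
    qed
    moreover have int_g: "integrable \<mu> g"
    proof (rule \<mu>.integrable_const_bound)
      have "\<bar>g z\<bar> \<le> A + 1 / (2 * s * d\<^sup>2)" for z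
      proof (cases "z \<le> d")
        case True
        then show ?thesis using J0 s by (simp add: g_def A_def)
      next
        case False
        have "1 / (2 * s * z\<^sup>2) \<le> 1 / (2 * s * d\<^sup>2)"
          using False d s by (intro divide_left_mono mult_left_mono power_mono) auto
        then show ?thesis using False J0 s by (simp add: g_def A_def add_increasing)
      qed
      then show "AE z in \<mu>. norm (g z) \<le> A + 1 / (2 * s * d\<^sup>2)" by simp
      show "g \<in> borel_measurable \<mu>" unfolding g_def by measurable
    qed
    ultimately have "J \<le> (LINT z|\<mu>. s / 2 * (phi z)\<^sup>2 + g z)"
      unfolding J_def using int_phi_m sq by (intro integral_mono) auto
    also have "\<dots> = s / 2 + integral\<^sup>L \<mu> g"
      using sq int_g norm by simp
    also have "integral\<^sup>L \<mu> g = d * A + (- 1 / (2 * s * 1) - - 1 / (2 * s * d))"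
    proof -
      have "((\<lambda>z. A) has_integral d * A) {0..d}"
        using has_integral_const_real[of A 0 d] d by simp
      then have "(g has_integral d * A) {0..d}"
        by (rule has_integral_eq[rotated]) (simp add: g_def)
      moreover have "(g has_integral (- 1 / (2 * s * 1) - - 1 / (2 * s * d))) {d..1}"
      proof (rule has_integral_spike_finite)
        show "((\<lambda>z. 1 / (2 * s * z\<^sup>2)) has_integral (- 1 / (2 * s * 1) - - 1 / (2 * s * d))) {d..1}"
          using False d s by (intro fundamental_theorem_of_calculus)
            (auto intro!: derivative_eq_intros simp: field_simps power2_eq_square
              simp flip: has_real_derivative_iff_has_vector_derivative)
        show "finite {d}" by simp
      qed (auto simp: g_def)
      ultimately have "(g has_integral (d * A + (- 1 / (2 * s * 1) - - 1 / (2 * s * d)))) {0..1}"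
        using False d by (intro has_integral_combine[of 0 d 1]) auto
      then show ?thesis using int_g by (simp add: lebesgue_integral_eq_integral integral_unique)
    qed
    finally have "J \<le> s / 2 + d * A + (1 / d) / (2 * s) - 1 / (2 * s)" by (simp add: mult.commute)
    also have "d * A = d * lam\<^sup>2 * J / 4" by (simp add: A_def)
    also have "\<dots> = J / 3" unfolding d(2) by simp
    also have "(1 / d) / (2 * s) = s / 2" unfolding s(2) using s(1) by simp
    \<comment> \<open>The term dropped comes from the endpoint 1.\<close>
    also have "s / 2 + J / 3 + s / 2 - 1 / (2 * s) \<le> s + J / 3" using s(1) by simp
    finally show ?thesis by simp
  qed
  have "\<bar>phi x\<bar> \<le> lam\<^sup>2 / 4 * x * J" using phi_le[of x] x by (simp add: m_def)
  also have "\<dots> \<le> lam\<^sup>2 / 4 * x * (3 / 2 * s)"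
    using x \<open>J \<le> 3 / 2 * s\<close> by (intro mult_left_mono) auto
  also have "\<dots> = 3 * sqrt 3 / 16 * (\<bar>lam\<bar>\<^sup>2 * \<bar>lam\<bar>) * x"
    by (simp add: s_def)
  also have "\<dots> = 3 * sqrt 3 / 16 * \<bar>lam\<bar> ^ 3 * x"
    by (simp only: power3_eq_cube power2_eq_square)
  finally show ?thesis .
qed

theorem theorem3p2:
  fixes phi :: "nat \<Rightarrow> real \<Rightarrow> real" and lam :: "nat \<Rightarrow> real"
  assumes "max_ortho_eigensystem phi lam"
  shows "\<forall>j. \<forall>x\<in>{0<..1}. \<bar>phi j x\<bar> / x \<le> C0 * \<bar>lam j\<bar> ^ 3"
proof (intro allI ballI)
  fix j and x :: real
  assume x: "x \<in> {0<..1}"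
  have "\<bar>phi j x\<bar> \<le> 3 * sqrt 3 / 16 * \<bar>lam j\<bar> ^ 3 * x"
    using assms x unfolding max_ortho_eigensystem_def by (intro eigenfun_linear_bound) auto
  then have "\<bar>phi j x\<bar> / x \<le> 3 * sqrt 3 / 16 * \<bar>lam j\<bar> ^ 3"
    using x by (simp add: pos_divide_le_eq)
  also have "\<dots> \<le> C0 * \<bar>lam j\<bar> ^ 3"
  proof (rule mult_right_mono)
    \<comment> \<open>\<open>16 / 9\<close> is the exact threshold for
      \<open>3 * sqrt 3 / 16 \<le> 1 / 3\<close>; squared, the claim is
      \<open>3 \<le> 256 / 81\<close>.\<close>
    have "sqrt 3 \<le> 16 / 9" by (rule real_le_lsqrt) (auto simp: power2_eq_square)
    then have "3 * sqrt 3 / 16 \<le> 1 / 3" by simp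
    also have "\<dots> \<le> C0" unfolding C0_def by simp
    finally show "3 * sqrt 3 / 16 \<le> C0" .
  qed simp
  finally show "\<bar>phi j x\<bar> / x \<le> C0 * \<bar>lam j\<bar> ^ 3" .
qed

end
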